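(* For every fixed even positive integer $m$ there exists a constant $C_1(m)>0$ depending only on $m$ such that for every sufficiently large even integer $n$, $$\alpha(m,n)>C_1(m)\cdot\frac{\binom{m}{m/2}^n}{n^{\frac{m-1}{2}}}.$$
   Context: For positive integers $m,n$, let $A(m,n)$ be the set of all $m\times n$ matrices with every entry in $\{1,-1\}$ such that every row sum and every column sum has absolute value at most $1$, and let $\alpha(m,n)=|A(m,n)|$. *)

theory Defs
  imports Complex_Main "Jordan_Normal_Form.Matrix"
begin

definition balanced_sign_mats :: "nat \<Rightarrow> nat \<Rightarrow> int mat set" where
  "balanced_sign_mats m n = {M \<in> carrier_mat m n.
     (\<forall>i<m. \<forall>j<n. M $$ (i, j) \<in> {1, -1}) \<and>
     (\<forall>i<m. \<bar>\<Sum>j<n. M $$ (i, j)\<bar> \<le> 1) \<and>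
     (\<forall>j<n. \<bar>\<Sum>i<m. M $$ (i, j)\<bar> \<le> 1)}"

definition alpha :: "nat \<Rightarrow> nat \<Rightarrow> nat" where
  "alpha m n = card (balanced_sign_mats m n)"

(* The cardinality in alpha is a genuine one (card of an infinite set would be 0). *)
lemma finite_balanced_sign_mats: "finite (balanced_sign_mats m n)"
proof -
  let ?I = "{..<m} \<times> {..<n}"
  have "finite (PiE ?I (\<lambda>_. {1, -1 :: int}))"
    by (intro finite_PiE) auto
  moreover have "balanced_sign_mats m n \<subseteq> mat m n ` PiE ?I (\<lambda>_. {1, -1 :: int})"
  proof
    fix M assume M: "M \<in> balanced_sign_mats m n"
    have "M = mat m n (restrict (\<lambda>p. M $$ p) ?I)"
      using M by (intro eq_matI) (auto simp: balanced_sign_mats_def)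
    moreover have "restrict (\<lambda>p. M $$ p) ?I \<in> PiE ?I (\<lambda>_. {1, -1 :: int})"
      using M by (auto simp: balanced_sign_mats_def)
    ultimately show "M \<in> mat m n ` PiE ?I (\<lambda>_. {1, -1 :: int})" by blast
  qed
  ultimately show ?thesis by (meson finite_imageI finite_subset)
qed

end

theory Submission
  imports Defs "HOL-Analysis.Convex"
begin

text \<open>
  Write \<open>n = 2k\<close>. The columns of a balanced matrix are steps of a random walk in \<open>\<int>\<^sup>m\<close> that
  must return to the origin. Since the set of steps is symmetric, such a closed walk is the same as a
  pair of walks of length \<open>k\<close> with a common endpoint. By Chebyshev's inequality at least half of the
  walks of length \<open>k\<close> end in a box of side \<open>O(\<surd>k)\<close>; as all steps lie in the hyperplane of
  coordinate sum zero, the box contains only \<open>O(k\<^bsup>(m-1)/2\<^esup>)\<close> endpoints, and the Cauchy-Schwarz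
  inequality bounds the number of pairs from below.
\<close>

section \<open>Cauchy-Schwarz for pairs with equal values\<close>

text \<open>Split \<open>G\<close> into the fibres of \<open>f\<close> over \<open>B\<close>. The
  fibre sizes add up to \<open>card G\<close>, their squares add up to the number of colliding
  ordered pairs, and Cauchy-Schwarz compares the two sums.\<close>

lemma card_squared_le_card_collisions:
  assumes "finite G" "finite B" "f ` G \<subseteq> B"
  shows "(card G)\<^sup>2 \<le> card {(x, y). x \<in> G \<and> y \<in> G \<and> f x = f y} * card B"
proof -
  define F where "F b = {x \<in> G. f x = b}" for b
  have finF: "finite (F b)" for b using assms(1) by (simp add: F_def)
  have "G = (\<Union>b\<in>B. F b)" using assms(3) by (auto simp: F_def)
  then have "card G = card (\<Union>b\<in>B. F b)" by simp
  also have "\<dots> = (\<Sum>b\<in>B. card (F b))"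
    by (rule card_UN_disjoint) (use assms(2) finF in \<open>auto simp: F_def\<close>)
  finally have G: "card G = (\<Sum>b\<in>B. card (F b))" .
  have "{(x, y). x \<in> G \<and> y \<in> G \<and> f x = f y} = (\<Union>b\<in>B. F b \<times> F b)"
    using assms(3) by (auto simp: F_def)
  then have "card {(x, y). x \<in> G \<and> y \<in> G \<and> f x = f y} = card (\<Union>b\<in>B. F b \<times> F b)" by simp
  also have "\<dots> = (\<Sum>b\<in>B. card (F b \<times> F b))"
    by (rule card_UN_disjoint) (use assms(2) finF in \<open>auto simp: F_def\<close>)
  finally have P: "card {(x, y). x \<in> G \<and> y \<in> G \<and> f x = f y} = (\<Sum>b\<in>B. (card (F b))\<^sup>2)"
    by (simp add: card_cartesian_product power2_eq_square)
  have "(\<Sum>b\<in>B. real (card (F b)))\<^sup>2 \<le> (\<Sum>b\<in>B. (real (card (F b)))\<^sup>2) * real (card B)"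
    by (rule sum_squared_le_sum_of_squares)
  then have "real ((\<Sum>b\<in>B. card (F b))\<^sup>2) \<le> real ((\<Sum>b\<in>B. (card (F b))\<^sup>2) * card B)"
    by simp
  then show ?thesis unfolding G P by (simp only: of_nat_le_iff)
qed

section \<open>Balanced columns as steps of a lattice walk\<close>

definition sign_of :: "'a set \<Rightarrow> 'a \<Rightarrow> int" where
  "sign_of T i = (if i \<in> T then 1 else -1)"

text \<open>A balanced column is encoded by the set of its positive entries.\<close>

definition half_sets :: "nat \<Rightarrow> nat set set" where
  "half_sets m = {T. T \<subseteq> {..<m} \<and> card T = m div 2}"

definition walks :: "nat \<Rightarrow> nat \<Rightarrow> nat set list set" where
  "walks m k = {ws. set ws \<subseteq> half_sets m \<and> length ws = k}"

definition position :: "'a set list \<Rightarrow> 'a \<Rightarrow> int" where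
  "position ws i = (\<Sum>T\<leftarrow>ws. sign_of T i)"

lemma sign_of_squared [simp]: "(sign_of T i)\<^sup>2 = 1"
  by (simp add: sign_of_def)

lemma finite_half_sets [simp]: "finite (half_sets m)"
  by (rule finite_subset[of _ "Pow {..<m}"]) (auto simp: half_sets_def)

lemma card_half_sets: "card (half_sets m) = m choose (m div 2)"
  using n_subsets[of "{..<m}" "m div 2"] by (simp add: half_sets_def)

lemma finite_walks [simp]: "finite (walks m k)"
  unfolding walks_def by (rule finite_lists_length_eq) simp

lemma card_walks: "card (walks m k) = (m choose (m div 2)) ^ k"
  unfolding walks_def by (simp add: card_lists_length_eq card_half_sets)

lemma walks_Suc: "walks m (Suc k) = (\<lambda>(ws, T). T # ws) ` (walks m k \<times> half_sets m)"
  unfolding walks_def by (rule lists_length_Suc_eq)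

lemma compl_half_sets:
  assumes "even m" "T \<in> half_sets m"
  shows "{..<m} - T \<in> half_sets m"
proof -
  have "card ({..<m} - T) = m - m div 2"
    using assms(2) by (subst card_Diff_subset) (auto simp: half_sets_def intro: finite_subset)
  then show ?thesis using assms(1) by (auto simp: half_sets_def elim!: evenE)
qed

lemma sign_of_compl: "i \<in> A \<Longrightarrow> sign_of (A - T) i = - sign_of T i"
  by (simp add: sign_of_def)

lemma sum_sign_of_half_set:
  assumes "even m" "T \<in> half_sets m"
  shows "(\<Sum>i<m. sign_of T i) = 0"
proof -
  have T: "T \<subseteq> {..<m}" "card T = m div 2" using assms(2) by (auto simp: half_sets_def)
  have "card ({..<m} - T) = m div 2"
    using compl_half_sets[OF assms] by (simp add: half_sets_def)
  moreover have "(\<Sum>i<m. sign_of T i) = (\<Sum>i\<in>{..<m} - T. sign_of T i) + (\<Sum>i\<in>T. sign_of T i)"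
    by (rule sum.subset_diff[OF T(1)]) simp
  ultimately show ?thesis using T by (simp add: sign_of_def)
qed

text \<open>Complementation permutes the half-size sets and flips every sign, so the sum equals its
  own negative. In probabilistic terms, a uniform random step has mean zero in each
  coordinate.\<close>

lemma sum_half_sets_sign_of:
  assumes "even m" "i < m"
  shows "(\<Sum>T\<in>half_sets m. sign_of T i) = 0"
proof -
  have inv: "{..<m} - ({..<m} - T) = T" if "T \<in> half_sets m" for T
    using that by (auto simp: half_sets_def)
  have "(\<Sum>T\<in>half_sets m. sign_of T i) = (\<Sum>T\<in>half_sets m. - sign_of T i)"
    by (rule sum.reindex_bij_witness[where i = "\<lambda>T. {..<m} - T" and j = "\<lambda>T. {..<m} - T"])
       (use assms in \<open>auto simp: compl_half_sets inv sign_of_compl\<close>)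
  then show ?thesis by (simp add: sum_negf)
qed

lemma position_Cons [simp]: "position (T # ws) i = sign_of T i + position ws i"
  by (simp add: position_def)

lemma position_append [simp]: "position (us @ ws) i = position us i + position ws i"
  by (simp add: position_def)

text \<open>This form shows the endpoint's coordinate \<open>i\<close> as the sum of row
  \<open>i\<close> in the matrix whose column \<open>j\<close> is \<open>ws ! j\<close>.\<close>

lemma position_conv_nth: "position ws i = (\<Sum>j<length ws. sign_of (ws ! j) i)"
  by (simp add: position_def sum_list_sum_nth atLeast0LessThan)

lemma position_map_compl: "i \<in> A \<Longrightarrow> position (map (\<lambda>T. A - T) ws) i = - position ws i"
  by (induction ws) (auto simp: position_def sign_of_compl)

text \<open>Each step has coordinate sum zero, so the walk stays in a hyperplane, and the last
  coordinate of its endpoint is determined by the others.\<close>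

lemma sum_position:
  assumes "even m" "set ws \<subseteq> half_sets m"
  shows "(\<Sum>i<m. position ws i) = 0"
  using assms(2)
  by (induction ws) (auto simp: position_def sum.distrib sum_sign_of_half_set[OF assms(1)])

section \<open>Second moment of the endpoint and Chebyshev's inequality\<close>

text \<open>Variances of independent steps add up: on prepending a step and expanding the square,
  the cross term cancels because steps have mean zero, and the new step contributes 1 per
  walk.\<close>

lemma sum_walks_position_squared:
  assumes "even m" "i < m"
  shows "(\<Sum>ws\<in>walks m k. (position ws i)\<^sup>2) = int k * int (card (walks m k))"
proof (induction k)
  case 0
  show ?case by (simp add: walks_def position_def)
next
  case (Suc k)
  let ?N = "int (card (half_sets m))"
  have inj: "inj_on (\<lambda>(ws, T). T # ws) (walks m k \<times> half_sets m)"
    by (auto simp: inj_on_def)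
  have "(\<Sum>ws\<in>walks m (Suc k). (position ws i)\<^sup>2)
      = (\<Sum>ws\<in>walks m k. \<Sum>T\<in>half_sets m. (sign_of T i + position ws i)\<^sup>2)"
    unfolding walks_Suc sum.reindex[OF inj] by (simp add: sum.cartesian_product case_prod_unfold)
  also have "\<dots> = (\<Sum>ws\<in>walks m k. ?N + ?N * (position ws i)\<^sup>2)"
  proof (rule sum.cong[OF refl])
    fix ws
    have "(\<Sum>T\<in>half_sets m. (sign_of T i + position ws i)\<^sup>2)
        = (\<Sum>T\<in>half_sets m. (1 + (position ws i)\<^sup>2) + sign_of T i * (2 * position ws i))"
      by (simp add: power2_sum algebra_simps)
    also have "\<dots> = ?N * (1 + (position ws i)\<^sup>2)"
      by (simp add: sum.distrib sum_half_sets_sign_of[OF assms] flip: sum_distrib_right)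
    finally show "(\<Sum>T\<in>half_sets m. (sign_of T i + position ws i)\<^sup>2)
        = ?N + ?N * (position ws i)\<^sup>2" by (simp add: algebra_simps)
  qed
  also have "\<dots> = ?N * int (card (walks m k)) + ?N * (int k * int (card (walks m k)))"
    by (simp add: sum.distrib Suc flip: sum_distrib_left)
  also have "\<dots> = int (Suc k) * int (card (walks m (Suc k)))"
    by (simp add: card_walks card_half_sets algebra_simps)
  finally show ?case .
qed

text \<open>Chebyshev's inequality: the squared norm of the endpoint averages \<open>m * k\<close>,
  while a walk ending outside the box has squared norm at least \<open>r\<^sup>2\<close>, which is
  at least twice that average. Hence at most half of the walks end outside.\<close>

lemma card_walks_le_twice_card_short:
  assumes "even m" "0 < m" "0 < k" "2 * m * k \<le> r\<^sup>2"
  shows "card (walks m k) \<le> 2 * card {ws \<in> walks m k. \<forall>i<m. \<bar>position ws i\<bar> \<le> int r}"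
proof -
  define bad where "bad = {ws \<in> walks m k. \<not> (\<forall>i<m. \<bar>position ws i\<bar> \<le> int r)}"
  have fin: "finite bad" by (simp add: bad_def)
  have "2 * int m * int k \<le> (\<Sum>i<m. (position ws i)\<^sup>2)" if ws: "ws \<in> bad" for ws
  proof -
    obtain i where i: "i < m" "int r < \<bar>position ws i\<bar>" using ws by (auto simp: bad_def)
    have "2 * int m * int k \<le> (int r)\<^sup>2"
      using assms(4) by (metis of_nat_le_iff of_nat_mult of_nat_numeral of_nat_power)
    also have "\<dots> \<le> \<bar>position ws i\<bar>\<^sup>2" using i by (intro power_mono) auto
    also have "\<dots> \<le> (\<Sum>i<m. (position ws i)\<^sup>2)"
      using i by (auto intro: member_le_sum)
    finally show ?thesis .
  qed
  then have "(\<Sum>ws\<in>bad. 2 * int m * int k) \<le> (\<Sum>ws\<in>bad. \<Sum>i<m. (position ws i)\<^sup>2)"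
    by (rule sum_mono)
  also have "\<dots> \<le> (\<Sum>ws\<in>walks m k. \<Sum>i<m. (position ws i)\<^sup>2)"
    by (rule sum_mono2) (auto simp: bad_def intro: sum_nonneg)
  also have "\<dots> = (\<Sum>i<m. \<Sum>ws\<in>walks m k. (position ws i)\<^sup>2)"
    by (rule sum.swap)
  also have "\<dots> = int m * int k * int (card (walks m k))"
    by (simp add: sum_walks_position_squared[OF assms(1)])
  finally have "(int m * int k) * (2 * int (card bad)) \<le> (int m * int k) * int (card (walks m k))"
    by (simp add: mult_ac)
  then have le: "2 * card bad \<le> card (walks m k)"
    using assms(2,3) by (simp add: mult_le_cancel_left_pos)
  have "{ws \<in> walks m k. \<forall>i<m. \<bar>position ws i\<bar> \<le> int r} = walks m k - bad"
    by (auto simp: bad_def)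
  then have "card {ws \<in> walks m k. \<forall>i<m. \<bar>position ws i\<bar> \<le> int r} = card (walks m k) - card bad"
    using fin by (simp add: card_Diff_subset bad_def)
  then show ?thesis using le by linarith
qed

section \<open>From walks to balanced matrices\<close>

text \<open>Use the steps as columns: they sum to zero, and the row sums are the endpoint's
  coordinates. A step is a subset of \<open>{..<m}\<close>, so its signs in the \<open>m\<close>
  rows recover it and the map is injective.\<close>

lemma card_closed_walks_le_alpha:
  assumes "even m"
  shows "card {ws \<in> walks m n. \<forall>i<m. position ws i = 0} \<le> alpha m n"
proof -
  define f where "f ws = mat m n (\<lambda>(i, j). sign_of (ws ! j) i)" for ws :: "nat set list"
  let ?Z = "{ws \<in> walks m n. \<forall>i<m. position ws i = 0}"
  have "inj_on f ?Z"
  proof (rule inj_onI)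
    fix us ws assume us: "us \<in> ?Z" and ws: "ws \<in> ?Z" and eq: "f us = f ws"
    have len: "length us = n" "length ws = n" using us ws by (auto simp: walks_def)
    show "us = ws"
    proof (rule nth_equalityI)
      fix j assume "j < length us"
      with len have j: "j < n" by simp
      have sub: "us ! j \<subseteq> {..<m}" "ws ! j \<subseteq> {..<m}"
        using us ws nth_mem[of j us, unfolded len, OF j] nth_mem[of j ws, unfolded len, OF j]
        by (auto simp: walks_def half_sets_def dest!: subsetD)
      have "(i \<in> us ! j) = (i \<in> ws ! j)" if "i < m" for i
      proof -
        have "f us $$ (i, j) = f ws $$ (i, j)" using eq by simp
        then show ?thesis using that j by (simp add: f_def sign_of_def split: if_splits)
      qed
      with sub show "us ! j = ws ! j" by auto
    qed (simp add: len)
  qed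
  moreover have "f ` ?Z \<subseteq> balanced_sign_mats m n"
  proof
    fix M assume "M \<in> f ` ?Z"
    then obtain ws where ws: "ws \<in> ?Z" and M: "M = f ws" by auto
    have len: "length ws = n" using ws by (simp add: walks_def)
    have "(\<Sum>j<n. sign_of (ws ! j) i) = 0" if "i < m" for i
      using ws that len position_conv_nth[of ws i] by auto
    moreover have "(\<Sum>i<m. sign_of (ws ! j) i) = 0" if "j < n" for j
      using ws that len nth_mem[of j ws]
      by (intro sum_sign_of_half_set[OF assms]) (auto simp: walks_def)
    ultimately show "M \<in> balanced_sign_mats m n"
      by (auto simp: M f_def balanced_sign_mats_def sign_of_def)
  qed
  ultimately show ?thesis
    unfolding alpha_def using finite_balanced_sign_mats by (rule card_inj_on_le)
qed

text \<open>Complementing every step negates the endpoint. Following \<open>us\<close> by the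
  complemented \<open>ws\<close> therefore gives a closed walk of length
  \<open>2 * k\<close>.\<close>

lemma card_collisions_le_alpha:
  assumes "even m" "P \<subseteq> {(us, ws). us \<in> walks m k \<and> ws \<in> walks m k \<and>
      (\<forall>i<m. position us i = position ws i)}"
  shows "card P \<le> alpha m (2 * k)"
proof -
  let ?Z = "{ws \<in> walks m (2 * k). \<forall>i<m. position ws i = 0}"
  define h where "h = (\<lambda>(us, ws :: nat set list). us @ map (\<lambda>T. {..<m} - T) ws)"
  have invo: "map (\<lambda>T. {..<m} - T) (map (\<lambda>T. {..<m} - T) ws) = ws" if "ws \<in> walks m k" for ws
    using that by (fastforce simp: walks_def half_sets_def intro!: map_idI)
  have "inj_on h P"
  proof (rule inj_onI)
    fix p q assume "p \<in> P" "q \<in> P" and eq: "h p = h q"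
    moreover obtain us ws us' ws' where [simp]: "p = (us, ws)" "q = (us', ws')" by fastforce
    ultimately have w: "us \<in> walks m k" "ws \<in> walks m k" "us' \<in> walks m k" "ws' \<in> walks m k"
      using assms(2) by auto
    \<comment> \<open>Both first halves have length \<open>k\<close>, so the concatenation splits
      uniquely.\<close>
    then have "us = us'" "map (\<lambda>T. {..<m} - T) ws = map (\<lambda>T. {..<m} - T) ws'"
      using eq by (auto simp: h_def walks_def)
    then show "p = q" using w invo by (metis \<open>p = (us, ws)\<close> \<open>q = (us', ws')\<close>)
  qed
  moreover have "h ` P \<subseteq> ?Z"
  proof (rule image_subsetI)
    fix p assume "p \<in> P"
    moreover obtain us ws where p: "p = (us, ws)" by fastforce
    ultimately have w: "us \<in> walks m k" "ws \<in> walks m k" "\<forall>i<m. position us i = position ws i"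
      using assms(2) by auto
    then have "h p \<in> walks m (2 * k)"
      using compl_half_sets[OF assms(1)] by (auto simp: p h_def walks_def)
    then show "h p \<in> ?Z" using w by (simp add: p h_def position_map_compl)
  qed
  ultimately have "card P \<le> card ?Z" by (rule card_inj_on_le) simp
  also have "\<dots> \<le> alpha m (2 * k)" by (rule card_closed_walks_le_alpha[OF assms(1)])
  finally show ?thesis .
qed

section \<open>The lower bound for \<open>alpha\<close> and its asymptotic form\<close>

text \<open>Cauchy-Schwarz is applied to the walks ending in the box; the factor 4 is the square of
  the 2 lost in Chebyshev's inequality.\<close>

lemma central_binomial_power_le_alpha:
  assumes "even m" "0 < m" "0 < k" "2 * m * k \<le> r\<^sup>2"
  shows "(m choose (m div 2)) ^ (2 * k) \<le> 4 * alpha m (2 * k) * (2 * r + 1) ^ (m - 1)"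
proof -
  let ?G = "{ws \<in> walks m k. \<forall>i<m. \<bar>position ws i\<bar> \<le> int r}"
  \<comment> \<open>Only the first \<open>m - 1\<close> coordinates are recorded. This gives the
    exponent \<open>m - 1\<close> instead of \<open>m\<close>, and finally the power
    \<open>(m - 1) / 2\<close> of \<open>n\<close>.\<close>
  let ?B = "{..<m - 1} \<rightarrow>\<^sub>E {- int r..int r}"
  let ?f = "\<lambda>ws. restrict (position ws) {..<m - 1}"
  let ?P = "{(us, ws). us \<in> ?G \<and> ws \<in> ?G \<and> ?f us = ?f ws}"
  have cardB: "card ?B = (2 * r + 1) ^ (m - 1)"
    by (simp add: card_PiE nat_add_distrib nat_mult_distrib)
  have "?f ` ?G \<subseteq> ?B"
    using assms(2) by (auto simp: abs_le_iff minus_le_iff intro!: restrict_PiE_iff[THEN iffD2])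
  then have CS: "(card ?G)\<^sup>2 \<le> card ?P * card ?B"
    by (intro card_squared_le_card_collisions finite_PiE) auto
  have "?P \<subseteq> {(us, ws). us \<in> walks m k \<and> ws \<in> walks m k \<and> (\<forall>i<m. position us i = position ws i)}"
  proof clarify
    fix us ws i
    assume us: "us \<in> walks m k" and ws: "ws \<in> walks m k" and eq: "?f us = ?f ws" and i: "i < m"
    have *: "position us i = position ws i" if "i < m - 1" for i
      using fun_cong[OF eq, of i] that by simp
    \<comment> \<open>Both full coordinate sums vanish, so agreement in the first
      \<open>m - 1\<close> coordinates forces agreement in the last.\<close>
    have "(\<Sum>i<Suc (m - 1). position us i) = (\<Sum>i<Suc (m - 1). position ws i)"
      using us ws assms(2) by (simp add: sum_position[OF assms(1)] walks_def del: sum.lessThan_Suc)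
    then have "position us (m - 1) = position ws (m - 1)" using * by simp
    with * i show "position us i = position ws i" by (cases "i = m - 1") auto
  qed
  then have P: "card ?P \<le> alpha m (2 * k)" by (rule card_collisions_le_alpha[OF assms(1)])
  have "(m choose (m div 2)) ^ (2 * k) = (card (walks m k))\<^sup>2"
    by (simp add: card_walks power_mult mult.commute)
  also have "\<dots> \<le> (2 * card ?G)\<^sup>2"
    by (intro power_mono card_walks_le_twice_card_short assms) simp
  also have "\<dots> = 4 * (card ?G)\<^sup>2" by (simp add: power_mult_distrib)
  also have "\<dots> \<le> 4 * (card ?P * card ?B)" using CS by simp
  also have "\<dots> \<le> 4 * (alpha m (2 * k) * card ?B)" using P by (intro mult_le_mono) auto
  finally show ?thesis unfolding cardB by (simp only: mult.assoc)
qed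

theorem theorem8:
  fixes m :: nat
  assumes "m > 0" and "even m"
  shows "\<exists>C\<^sub>1 :: real. C\<^sub>1 > 0 \<and>
    (\<forall>\<^sub>F n :: nat in sequentially. even n \<longrightarrow>
       real (alpha m n) >
         C\<^sub>1 * (real (m choose (m div 2)) ^ n / real n powr ((real m - 1) / 2)))"
proof -
  \<comment> \<open>Chosen so that \<open>2 * r + 1\<close> is at most \<open>c * sqrt k\<close>:
    the 3 collects the 1 and twice the rounding error of \<open>r\<close>, and is absorbed using
    \<open>sqrt k\<close> \<ge> 1.\<close>
  define c where "c = 2 * sqrt (2 * real m) + 3"
  \<comment> \<open>The counting bound gives the constant 4; doubling it to 8 makes the final
    inequality strict.\<close>
  define C where "C = 1 / (8 * c ^ (m - 1))"
  have c: "c > 0" unfolding c_def by (intro add_nonneg_pos) auto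
  have "C * (real (m choose (m div 2)) ^ n / real n powr ((real m - 1) / 2)) < real (alpha m n)"
    if n: "even n" "n \<ge> 1" for n
  proof -
    let ?N = "real (m choose (m div 2)) ^ n"
    define D where "D = c ^ (m - 1) * real n powr ((real m - 1) / 2)"
    define k where "k = n div 2"
    have k: "n = 2 * k" "k > 0" using n by (auto simp: k_def elim!: evenE)
    \<comment> \<open>The least box radius that Chebyshev's inequality admits here, of order
      \<open>sqrt k\<close>.\<close>
    define r where "r = nat \<lceil>sqrt (2 * real m * real k)\<rceil>"
    have "0 \<le> sqrt (2 * real m * real k)" by simp
    then have r: "sqrt (2 * real m * real k) \<le> real r" "real r \<le> sqrt (2 * real m * real k) + 1"
      unfolding r_def by linarith+
    have "(sqrt (2 * real m * real k))\<^sup>2 \<le> (real r)\<^sup>2" using r(1) by (intro power_mono) auto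
    then have "real (2 * m * k) \<le> real (r\<^sup>2)" by simp
    then have "2 * m * k \<le> r\<^sup>2" by (simp only: of_nat_le_iff)
    then have "(m choose (m div 2)) ^ n \<le> 4 * alpha m n * (2 * r + 1) ^ (m - 1)"
      unfolding k(1) by (intro central_binomial_power_le_alpha assms k)
    then have "real ((m choose (m div 2)) ^ n) \<le> real (4 * alpha m n * (2 * r + 1) ^ (m - 1))"
      by (simp only: of_nat_le_iff)
    then have main: "?N \<le> 4 * real (alpha m n) * (2 * real r + 1) ^ (m - 1)"
      by (simp add: add.commute)
    have sk: "1 \<le> sqrt (real k)" "sqrt (real k) \<le> sqrt (real n)" using k by auto
    have "2 * real r + 1 \<le> 2 * (sqrt (2 * real m) * sqrt (real k)) + 3"
      using r(2) by (simp add: real_sqrt_mult)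
    also have "\<dots> \<le> c * sqrt (real k)" using sk by (simp add: c_def algebra_simps)
    also have "\<dots> \<le> c * sqrt (real n)" using sk c by simp
    finally have "(2 * real r + 1) ^ (m - 1) \<le> (c * sqrt (real n)) ^ (m - 1)"
      by (intro power_mono) auto
    also have "\<dots> = c ^ (m - 1) * real n powr ((real m - 1) / 2)"
    proof -
      have "sqrt (real n) ^ (m - 1) = (real n powr (1 / 2)) powr real (m - 1)"
        using n by (simp only: powr_half_sqrt powr_realpow) (simp add: powr_realpow)
      also have "\<dots> = real n powr ((real m - 1) / 2)"
        using assms(1) by (simp add: powr_powr of_nat_diff)
      finally show ?thesis by (simp only: power_mult_distrib)
    qed
    finally have le: "(2 * real r + 1) ^ (m - 1) \<le> D" by (simp only: D_def)
    have N: "?N \<le> 4 * real (alpha m n) * D"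
      by (rule order_trans[OF main]) (rule mult_left_mono[OF le], simp)
    \<comment> \<open>Positivity of \<open>?N\<close> makes the right-hand side of \<open>N\<close>
      positive, so doubling that side yields a strict bound.\<close>
    have "0 < ?N" by simp
    also note N
    finally have "0 < 4 * real (alpha m n) * D" .
    then have less: "?N < real (alpha m n) * (8 * D)" using N by linarith
    have "D > 0" using c n by (simp add: D_def)
    then have "?N / (8 * D) < real (alpha m n)" using less by (subst pos_divide_less_eq) auto
    moreover have "C * (?N / real n powr ((real m - 1) / 2)) = ?N / (8 * D)"
      by (simp only: C_def D_def times_divide_times_eq mult.assoc mult_1_left)
    ultimately show ?thesis by (simp only:)
  qed
  then have "\<forall>\<^sub>F n in sequentially. even n \<longrightarrow>
      real (alpha m n) > C * (real (m choose (m div 2)) ^ n / real n powr ((real m - 1) / 2))"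
    by (intro eventually_sequentiallyI[of 1] impI)
  moreover have "C > 0" using c by (simp add: C_def)
  ultimately show ?thesis by blast
qed

end
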